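(* Let $p$ be a prime and $\frac{a}{p}$ an irreducible fraction. If $\mathcal{S}_{\frac{a}{p}}(q)$ is reducible in $\mathbb Q[q]$, then every irreducible factor of $\mathcal{S}_{\frac{a}{p}}(q)$ in $\mathbb Q[q]$ has degree at least $7$.
   Context: For an integer $c$, $[c]_q=\frac{1-q^c}{1-q}$. Every rational $\alpha>1$ has a unique negative continued fraction expansion $\alpha=c_1-\cfrac{1}{c_2-\cfrac{1}{\ddots-\cfrac{1}{c_l}}}$ with integers $c_j\ge 2$. Put $M^-_q(c)=\begin{pmatrix}[c]_q & -q^{c-1}\\ 1 & 0\end{pmatrix}$ and define $\mathcal{R}_\alpha(q),\mathcal{S}_\alpha(q)$ by $\begin{pmatrix}\mathcal{R}_\alpha(q)\\ \mathcal{S}_\alpha(q)\end{pmatrix}=M^-_q(c_1)\cdots M^-_q(c_l)\begin{pmatrix}1\\0\end{pmatrix}$. For rational $\alpha\le 1$ they are defined recursively by $\mathcal{S}_\alpha(q)=\mathcal{S}_{\alpha+1}(q)$ and $\mathcal{R}_\alpha(q)=q^{-1}(\mathcal{R}_{\alpha+1}(q)-\mathcal{S}_{\alpha+1}(q))$. $\mathcal{S}_\alpha(q)\in\mathbb Z[q]$. *)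

theory Defs
  imports
    "HOL-Analysis.Cartesian_Space"
    "HOL-Computational_Algebra.Polynomial_Factorial"
begin

text \<open>Polynomials in \<open>q\<close>; the indeterminate is \<open>monom 1 1\<close>.
  The division below is exact, see \<open>q_int_mult\<close>.\<close>

definition q_int :: "nat \<Rightarrow> int poly" where
  "q_int c = (1 - monom 1 c) div (1 - monom 1 1)"

lemma q_int_eq_sum_aux: "(1 - monom 1 1) * (\<Sum>i<c. monom (1::int) i) = 1 - monom 1 c"
proof (induction c)
  case (Suc c)
  have "(1 - monom 1 1) * (\<Sum>i<Suc c. monom (1::int) i)
      = (1 - monom 1 c) + (1 - monom 1 1) * monom 1 c"
    unfolding Suc.IH[symmetric] by (simp add: distrib_left)
  then show ?case by (simp add: left_diff_distrib mult_monom)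
qed simp

lemma q_int_eq_sum: "q_int c = (\<Sum>i<c. monom 1 i)"
proof -
  have "coeff (1 - monom 1 1 :: int poly) 0 \<noteq> coeff 0 0"
    by simp
  then have nz: "(1 - monom 1 1 :: int poly) \<noteq> 0"
    by metis
  show ?thesis
    unfolding q_int_def q_int_eq_sum_aux[of c, symmetric]
    using nz by (rule nonzero_mult_div_cancel_left)
qed

lemma q_int_mult: "(1 - monom 1 1) * q_int c = 1 - monom 1 c"
  unfolding q_int_eq_sum by (rule q_int_eq_sum_aux)

fun neg_cf :: "nat list \<Rightarrow> rat" where
  "neg_cf [] = 0"
| "neg_cf [c] = of_nat c"
| "neg_cf (c # d # cs) = of_nat c - 1 / neg_cf (d # cs)"

definition is_neg_cf_expansion :: "rat \<Rightarrow> nat list \<Rightarrow> bool" where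
  "is_neg_cf_expansion \<alpha> cs \<longleftrightarrow> cs \<noteq> [] \<and> (\<forall>c \<in> set cs. 2 \<le> c) \<and> neg_cf cs = \<alpha>"

definition neg_cf_expansion :: "rat \<Rightarrow> nat list" where
  "neg_cf_expansion \<alpha> = (THE cs. is_neg_cf_expansion \<alpha> cs)"

lemma neg_cf_gt_1: "cs \<noteq> [] \<Longrightarrow> \<forall>c \<in> set cs. 2 \<le> c \<Longrightarrow> 1 < neg_cf cs"
proof (induction cs rule: neg_cf.induct)
  case (3 c d cs)
  then have "1 < neg_cf (d # cs)" by simp
  then have "1 / neg_cf (d # cs) < 1" by simp
  moreover have "(2::rat) \<le> of_nat c" using 3 by simp
  ultimately show ?case by simp
qed auto

lemma neg_cf_ceiling:
  assumes "\<forall>c \<in> set (c # cs). 2 \<le> c"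
  shows "\<lceil>neg_cf (c # cs)\<rceil> = int c"
proof (cases cs)
  case (Cons d ds)
  then have "1 < neg_cf cs" using assms by (intro neg_cf_gt_1) auto
  then have "0 < 1 / neg_cf cs" "1 / neg_cf cs < 1" by simp_all
  then show ?thesis using Cons by (intro ceiling_unique) simp_all
qed simp

lemma is_neg_cf_expansion_unique:
  "is_neg_cf_expansion \<alpha> cs \<Longrightarrow> is_neg_cf_expansion \<alpha> ds \<Longrightarrow> cs = ds"
proof (induction cs arbitrary: \<alpha> ds)
  case Nil
  then show ?case by (simp add: is_neg_cf_expansion_def)
next
  case (Cons c cs)
  obtain d ds' where ds: "ds = d # ds'"
    using Cons.prems by (cases ds) (auto simp: is_neg_cf_expansion_def)
  have all: "\<forall>x \<in> set (c # cs). 2 \<le> x" "\<forall>x \<in> set (d # ds'). 2 \<le> x"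
    and eq: "neg_cf (c # cs) = neg_cf (d # ds')"
    using Cons.prems ds by (auto simp: is_neg_cf_expansion_def)
  have cd: "c = d"
    using neg_cf_ceiling[OF all(1)] neg_cf_ceiling[OF all(2)] eq by simp
  have gt: "cs \<noteq> [] \<Longrightarrow> 1 < neg_cf cs" "ds' \<noteq> [] \<Longrightarrow> 1 < neg_cf ds'"
    using all by (auto intro!: neg_cf_gt_1)
  have "cs = ds'"
  proof (cases "cs = [] \<or> ds' = []")
    case True
    then show ?thesis using eq cd gt by (cases cs; cases ds') auto
  next
    case False
    then have "1 / neg_cf cs = 1 / neg_cf ds'"
      using eq cd by (cases cs; cases ds') auto
    then have "neg_cf cs = neg_cf ds'" by simp
    then show ?thesis
      using Cons.IH[of "neg_cf cs" ds'] False all by (auto simp: is_neg_cf_expansion_def)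
  qed
  then show ?case using cd ds by simp
qed

lemma is_neg_cf_expansion_exists:
  fixes m n :: nat
  assumes "0 < n" "n < m"
  shows "\<exists>cs. is_neg_cf_expansion (of_nat m / of_nat n) cs"
  using assms
proof (induction n arbitrary: m rule: less_induct)
  case (less n)
  define r where "r = m mod n"
  define k where "k = m div n"
  have m: "m = k * n + r" by (simp add: r_def k_def)
  have k: "1 \<le> k" using less.prems by (simp add: k_def div_greater_zero_iff Suc_le_eq)
  show ?case
  proof (cases "r = 0")
    case True
    then have "2 \<le> k" using less.prems m k by (cases "k = 1") auto
    then have "is_neg_cf_expansion (of_nat m / of_nat n) [k]"
      using True m less.prems by (simp add: is_neg_cf_expansion_def)
    then show ?thesis by blast
  next
    case False
    have r: "0 < r" "r < n" using False less.prems by (simp_all add: r_def)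
    then obtain cs where cs: "is_neg_cf_expansion (of_nat n / of_nat (n - r)) cs"
      using less.IH[of "n - r" n] less.prems by auto
    then obtain d ds where dds: "cs = d # ds"
      by (cases cs) (auto simp: is_neg_cf_expansion_def)
    have "neg_cf ((k + 1) # cs) = of_nat (k + 1) - of_nat (n - r) / of_nat n"
      using cs dds by (simp add: is_neg_cf_expansion_def)
    also have "\<dots> = of_nat m / (of_nat n :: rat)"
      using r less.prems by (simp add: m of_nat_diff field_simps)
    finally have "is_neg_cf_expansion (of_nat m / of_nat n) ((k + 1) # cs)"
      using cs k by (auto simp: is_neg_cf_expansion_def)
    then show ?thesis by blast
  qed
qed

lemma ex1_neg_cf_expansion:
  assumes "1 < \<alpha>"
  shows "\<exists>!cs. is_neg_cf_expansion \<alpha> cs"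
proof -
  obtain a b :: int where ab: "\<alpha> = of_int a / of_int b" "0 < b"
    by (metis Fract_of_int_quotient Rat_cases)
  have "(of_int b :: rat) < of_int a" using assms ab by (simp add: field_simps)
  then have "b < a" by simp
  then have "0 < nat b" "nat b < nat a" "\<alpha> = of_nat (nat a) / of_nat (nat b)"
    using ab by simp_all
  then show ?thesis
    using is_neg_cf_expansion_exists is_neg_cf_expansion_unique by metis
qed

lemma neg_cf_expansion: "1 < \<alpha> \<Longrightarrow> is_neg_cf_expansion \<alpha> (neg_cf_expansion \<alpha>)"
  unfolding neg_cf_expansion_def by (rule theI') (rule ex1_neg_cf_expansion)

definition M_q :: "nat \<Rightarrow> int poly ^ 2 ^ 2" where
  "M_q c = vector [vector [q_int c, - monom 1 (c - 1)],
                   vector [1,       0]]"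

definition RS_cf :: "nat list \<Rightarrow> int poly ^ 2" where
  "RS_cf cs = foldr (\<lambda>c A. M_q c ** A) cs (mat 1) *v vector [1, 0]"

text \<open>The denominator \<open>\<S>\<^sub>\<alpha>(q)\<close> of the \<open>q\<close>-rational.  The recursion extending \<open>(\<R>\<^sub>\<alpha>, \<S>\<^sub>\<alpha>)\<close> to
  \<open>\<alpha> \<le> 1\<close> does not use \<open>\<R>\<close> (which need not be a polynomial) in its second component, so
  \<open>\<S>\<close> is defined on its own.\<close>

function q_denom :: "rat \<Rightarrow> int poly" where
  "q_denom \<alpha> = (if 1 < \<alpha> then RS_cf (neg_cf_expansion \<alpha>) $ 2 else q_denom (\<alpha> + 1))"
  by auto
termination
proof (relation "measure (\<lambda>\<alpha>. nat (2 - \<lfloor>\<alpha>\<rfloor>))")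
  fix \<alpha> :: rat
  assume "\<not> 1 < \<alpha>"
  then have "\<lfloor>\<alpha>\<rfloor> \<le> 1" by linarith
  then show "(\<alpha> + 1, \<alpha>) \<in> measure (\<lambda>\<alpha>. nat (2 - \<lfloor>\<alpha>\<rfloor>))" by simp
qed simp

declare q_denom.simps [simp del]

definition reducible :: "'a::comm_semiring_1 \<Rightarrow> bool" where
  "reducible f \<longleftrightarrow> f \<noteq> 0 \<and> (\<exists>g h. f = g * h \<and> \<not> g dvd 1 \<and> \<not> h dvd 1)"

end

theory Submission
  imports Defs
begin

text \<open>At \<open>q = - 1\<close>, \<open>q = \<i>\<close> and \<open>q = \<omega>\<close> (a primitive cube root of unity) the matrices \<open>M\<^sub>q(c)\<close>
  generate a finite group modulo units, and \<open>\<S>\<close> takes a unit value there if \<open>p > 3\<close>.  Hence so does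
  every factor \<open>f\<close> of \<open>\<S>\<close>, which by Gauss's lemma and the positivity of the coefficients of \<open>\<S>\<close> may
  be taken monic and integral with \<open>f(0) = 1\<close>.  In degree at most 6 these conditions leave finitely
  many \<open>f\<close>, and all of them satisfy \<open>f(1) > 1\<close>.  In a factorization \<open>\<S> = f h\<close> with \<open>deg f \<le> 6\<close> we
  thus have \<open>f(1) = p\<close> and \<open>h(1) = 1\<close>, so \<open>deg h \<ge> 7\<close>.  This leaves finitely many primes \<open>p\<close>; for
  each of them, \<open>f(2)\<close> never divides \<open>\<S>(2)\<close> when \<open>\<S>(2) \<ge> 2 ^ (deg f + 7)\<close>.\<close>

section \<open>The recursion for \<open>\<R>\<close> and \<open>\<S>\<close>\<close>

lemma RS_cf_Nil [simp]: "RS_cf [] $ 1 = 1" "RS_cf [] $ 2 = 0"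
  by (simp_all add: RS_cf_def)

lemma RS_cf_Cons [simp]:
  "RS_cf (c # cs) $ 1 = q_int c * RS_cf cs $ 1 - monom 1 (c - 1) * RS_cf cs $ 2"
  "RS_cf (c # cs) $ 2 = RS_cf cs $ 1"
proof -
  have "RS_cf (c # cs) = M_q c *v RS_cf cs"
    by (simp add: RS_cf_def matrix_vector_mul_assoc)
  then show "RS_cf (c # cs) $ 1 = q_int c * RS_cf cs $ 1 - monom 1 (c - 1) * RS_cf cs $ 2"
    "RS_cf (c # cs) $ 2 = RS_cf cs $ 1"
    by (simp_all add: matrix_vector_mult_def sum_2 M_q_def)
qed

text \<open>Each unfolding of \<open>q_denom\<close> at or below 1 shifts the argument by one and
  keeps the value, so \<open>k\<close> shifts lead to a genuine expansion.\<close>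

lemma q_denom_eq_RS_cf:
  "\<exists>k cs. is_neg_cf_expansion (\<alpha> + of_nat k) cs \<and> q_denom \<alpha> = RS_cf cs $ 2"
proof (induction \<alpha> rule: q_denom.induct)
  case (1 \<alpha>)
  show ?case
  proof (cases "1 < \<alpha>")
    case True
    then have "is_neg_cf_expansion (\<alpha> + of_nat 0) (neg_cf_expansion \<alpha>)"
      by (simp add: neg_cf_expansion)
    with True show ?thesis by (metis q_denom.simps)
  next
    case False
    then obtain k cs where "is_neg_cf_expansion (\<alpha> + 1 + of_nat k) cs"
      "q_denom (\<alpha> + 1) = RS_cf cs $ 2"
      using 1 by blast
    then have "is_neg_cf_expansion (\<alpha> + of_nat (Suc k)) cs" "q_denom \<alpha> = RS_cf cs $ 2"
      using False by (simp_all add: add.assoc q_denom.simps[of \<alpha>])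
    then show ?thesis by blast
  qed
qed

lemma q_int_Suc: "q_int (Suc c) = 1 + monom 1 1 * q_int c"
  unfolding q_int_eq_sum
  by (simp add: sum.lessThan_Suc_shift sum_distrib_left mult_monom monom_0 one_pCons
      del: sum.lessThan_Suc)

lemma degree_q_int: "0 < c \<Longrightarrow> degree (q_int c) = c - 1 \<and> coeff (q_int c) (c - 1) = 1"
proof -
  assume "0 < c"
  have co: "coeff (q_int c) i = (if i < c then 1 else 0)" for i
    by (simp add: q_int_eq_sum coeff_sum)
  have "degree (q_int c) = c - 1"
    using \<open>0 < c\<close> by (intro antisym degree_le le_degree) (auto simp: co)
  with co \<open>0 < c\<close> show ?thesis by simp
qed

text \<open>Both terms of the recursion gain degree \<open>c - 1\<close>, and \<open>S\<close> has
  smaller degree than \<open>R\<close>, so \<open>q_int c * R\<close> decides the leading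
  coefficient. It also decides the constant term, since \<open>c \<ge> 2\<close>. The degree
  comparison keeps the induction going.\<close>

lemma RS_cf_monic:
  assumes "\<forall>c \<in> set cs. 2 \<le> c"
  shows "lead_coeff (RS_cf cs $ 1) = 1 \<and> coeff (RS_cf cs $ 1) 0 = 1 \<and>
    (RS_cf cs $ 2 = 0 \<or> degree (RS_cf cs $ 2) < degree (RS_cf cs $ 1))"
  using assms
proof (induction cs)
  case Nil
  then show ?case by simp
next
  case (Cons c cs)
  define R S where "R = RS_cf cs $ 1" and "S = RS_cf cs $ 2"
  have IH: "lead_coeff R = 1" "coeff R 0 = 1" "S = 0 \<or> degree S < degree R" and c: "2 \<le> c"
    using Cons by (auto simp: R_def S_def)
  have R0: "R \<noteq> 0" using IH by auto
  have q: "degree (q_int c) = c - 1" "lead_coeff (q_int c) = 1"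
    using degree_q_int[of c] c by simp_all
  have q0: "q_int c \<noteq> 0" using q by auto
  have d: "degree (q_int c * R) = c - 1 + degree R"
    using q R0 q0 by (simp add: degree_mult_eq)
  have l: "lead_coeff (q_int c * R) = 1"
    using q IH by (simp add: lead_coeff_mult)
  have "degree (- (monom 1 (c - 1) * S)) < degree (q_int c * R)"
  proof (cases "S = 0")
    case True
    then show ?thesis using d c by simp
  next
    case False
    then have "degree (monom 1 (c - 1) * S) = c - 1 + degree S"
      by (simp add: degree_mult_eq degree_monom_eq)
    then show ?thesis using d IH False by simp
  qed
  then have "degree (q_int c * R + - (monom 1 (c - 1) * S)) = degree (q_int c * R)"
    "lead_coeff (q_int c * R + - (monom 1 (c - 1) * S)) = lead_coeff (q_int c * R)"
    by (rule degree_add_eq_left, metis add.commute lead_coeff_add_le)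
  moreover have "coeff (q_int c * R - monom 1 (c - 1) * S) 0 = 1"
    using IH c by (simp add: coeff_mult q_int_eq_sum coeff_sum)
  moreover have "degree R < c - 1 + degree R" using c by simp
  ultimately have "lead_coeff (q_int c * R - monom 1 (c - 1) * S) = 1"
    "coeff (q_int c * R - monom 1 (c - 1) * S) 0 = 1"
    "degree R < degree (q_int c * R - monom 1 (c - 1) * S)"
    using l d by simp_all
  then show ?case unfolding RS_cf_Cons R_def S_def by blast
qed

section \<open>Nonnegativity of the coefficients\<close>

definition nonneg_coeffs :: "int poly \<Rightarrow> bool" where
  "nonneg_coeffs f \<longleftrightarrow> (\<forall>i. 0 \<le> coeff f i)"

lemma nonneg_coeffs_add: "nonneg_coeffs f \<Longrightarrow> nonneg_coeffs g \<Longrightarrow> nonneg_coeffs (f + g)"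
  by (simp add: nonneg_coeffs_def)

lemma nonneg_coeffs_mult: "nonneg_coeffs f \<Longrightarrow> nonneg_coeffs g \<Longrightarrow> nonneg_coeffs (f * g)"
  by (auto simp: nonneg_coeffs_def coeff_mult intro!: sum_nonneg)

lemma nonneg_coeffs_monom: "nonneg_coeffs (monom 1 n)"
  by (simp add: nonneg_coeffs_def)

lemma nonneg_coeffs_sum: "(\<And>i. i \<in> A \<Longrightarrow> nonneg_coeffs (f i)) \<Longrightarrow> nonneg_coeffs (sum f A)"
  by (auto simp: nonneg_coeffs_def coeff_sum intro!: sum_nonneg)

text \<open>The recursion subtracts, so the induction has to carry \<open>R - S\<close>: for
  \<open>c = k + 2\<close> the new difference is
  \<open>q * q_int k * R + q^(k+1) * (R - S)\<close>.\<close>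

lemma RS_cf_nonneg_coeffs:
  assumes "\<forall>c \<in> set cs. 2 \<le> c"
  shows "nonneg_coeffs (RS_cf cs $ 2) \<and> nonneg_coeffs (RS_cf cs $ 1 - RS_cf cs $ 2)"
  using assms
proof (induction cs)
  case Nil
  show ?case using nonneg_coeffs_monom[of 0] by (simp add: nonneg_coeffs_def)
next
  case (Cons c cs)
  define R S where "R = RS_cf cs $ 1" and "S = RS_cf cs $ 2"
  obtain k where c: "c = Suc (Suc k)"
    using Cons.prems by (auto dest!: le_Suc_ex)
  have S: "nonneg_coeffs S" and RS: "nonneg_coeffs (R - S)"
    using Cons by (auto simp: R_def S_def)
  then have R: "nonneg_coeffs R" using nonneg_coeffs_add[of S "R - S"] by simp
  have "q_int c = 1 + monom 1 1 * q_int k + monom 1 (Suc k)"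
    using q_int_Suc[of k] by (simp add: c q_int_eq_sum)
  then have "q_int c * R - monom 1 (c - 1) * S - R
      = monom 1 1 * q_int k * R + monom 1 (Suc k) * (R - S)"
    by (simp add: c algebra_simps)
  also have "nonneg_coeffs \<dots>"
    using R RS unfolding q_int_eq_sum
    by (intro nonneg_coeffs_add nonneg_coeffs_mult nonneg_coeffs_sum nonneg_coeffs_monom)
  finally show ?case using R by (simp add: R_def S_def)
qed

section \<open>Specialization at \<open>q = 1\<close>\<close>

lemma poly_q_int_1: "poly (q_int c) 1 = int c"
  by (simp add: q_int_eq_sum poly_sum poly_monom)

text \<open>At \<open>q = 1\<close> the pair \<open>(r, s)\<close> becomes
  \<open>(c * r - s, r)\<close>, the classical recursion for numerators and denominators; a common
  divisor of the new pair divides the old one.\<close>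

lemma RS_cf_at_1:
  assumes "\<forall>c \<in> set cs. 2 \<le> c"
  defines "r \<equiv> poly (RS_cf cs $ 1) 1" and "s \<equiv> poly (RS_cf cs $ 2) 1"
  shows "coprime r s \<and> 0 \<le> s \<and> s < r \<and>
    (cs \<noteq> [] \<longrightarrow> 0 < s \<and> neg_cf cs = of_int r / of_int s)"
  using assms(1) unfolding r_def s_def
proof (induction cs)
  case Nil
  then show ?case by simp
next
  case (Cons c cs)
  define r s where "r = poly (RS_cf cs $ 1) 1" and "s = poly (RS_cf cs $ 2) 1"
  have IH: "coprime r s" "0 \<le> s" "s < r" "cs \<noteq> [] \<longrightarrow> 0 < s \<and> neg_cf cs = of_int r / of_int s"
    and c: "2 \<le> c"
    using Cons by (auto simp: r_def s_def)
  have eq: "poly (RS_cf (c # cs) $ 1) 1 = int c * r - s" "poly (RS_cf (c # cs) $ 2) 1 = r"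
    by (simp_all add: r_def s_def poly_q_int_1 poly_monom)
  have "coprime (int c * r - s) r"
  proof (rule coprimeI)
    fix d assume d: "d dvd int c * r - s" "d dvd r"
    then have "d dvd int c * r - (int c * r - s)" by (intro dvd_diff dvd_mult d)
    also have "int c * r - (int c * r - s) = s" by simp
    finally have "d dvd s" .
    with IH(1) d(2) show "is_unit d" by (rule coprime_common_divisor)
  qed
  moreover have "2 * r \<le> int c * r" using c IH by (intro mult_right_mono) auto
  then have "r < int c * r - s" using IH by linarith
  moreover have "neg_cf (c # cs) = of_int (int c * r - s) / of_int r"
  proof (cases cs)
    case Nil
    then show ?thesis using IH by (simp add: r_def s_def)
  next
    case (Cons d ds)
    then show ?thesis using IH by (simp add: field_simps)
  qed
  ultimately show ?case unfolding eq using IH by simp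
qed

section \<open>Evaluation at roots of unity\<close>

text \<open>One evaluation for integer, real and complex points that keeps the coefficients in
  \<open>int\<close>.\<close>

definition int_poly_at :: "'a::comm_ring_1 \<Rightarrow> int poly \<Rightarrow> 'a" where
  "int_poly_at z f = poly (map_poly of_int f) z"

lemma map_poly_of_int_add:
  "map_poly of_int (f + g) = (map_poly of_int f + map_poly of_int g :: 'a::comm_ring_1 poly)"
  by (rule poly_eqI) (simp add: coeff_map_poly)

lemma map_poly_of_int_mult:
  "map_poly of_int (f * g) = (map_poly of_int f * map_poly of_int g :: 'a::comm_ring_1 poly)"
  by (rule poly_eqI) (simp add: coeff_map_poly coeff_mult)

lemma int_poly_at_0 [simp]: "int_poly_at z 0 = 0"
  and int_poly_at_1 [simp]: "int_poly_at z 1 = 1"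
  and int_poly_at_pCons [simp]: "int_poly_at z (pCons a f) = of_int a + z * int_poly_at z f"
  by (simp_all add: int_poly_at_def map_poly_pCons)

lemma int_poly_at_add [simp]: "int_poly_at z (f + g) = int_poly_at z f + int_poly_at z g"
  and int_poly_at_mult [simp]: "int_poly_at z (f * g) = int_poly_at z f * int_poly_at z g"
  by (simp_all add: int_poly_at_def map_poly_of_int_add map_poly_of_int_mult)

lemma int_poly_at_diff [simp]: "int_poly_at z (f - g) = int_poly_at z f - int_poly_at z g"
  using int_poly_at_add[of z "f - g" g] by (simp add: algebra_simps del: int_poly_at_add)

lemma int_poly_at_monom [simp]: "int_poly_at z (monom 1 n) = z ^ n"
  by (simp add: int_poly_at_def map_poly_monom poly_monom)

lemma int_poly_at_of_int: "int_poly_at (of_int x) f = of_int (poly f x)"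
  by (induction f) simp_all

text \<open>The matrix of \<open>c\<close> is a product of the maps in \<open>shear\<close> and \<open>rot\<close>.  At a root of unity \<open>z\<close> of
  order at most five they generate a finite group modulo units.\<close>

lemma RS_cf_invariant:
  fixes z :: "'a::comm_ring_1"
  assumes base: "P 1 0"
    and shear: "\<And>x y. P x y \<Longrightarrow> P (z * x + y) y"
    and rot: "\<And>x y. P x y \<Longrightarrow> P (x - y) x"
    and cs: "\<forall>c \<in> set cs. 2 \<le> c"
  shows "P (int_poly_at z (RS_cf cs $ 1)) (int_poly_at z (RS_cf cs $ 2))"
  using cs
proof (induction cs)
  case Nil
  then show ?case using base by simp
next
  case (Cons c cs)
  define x y where "x = int_poly_at z (RS_cf cs $ 1)" and "y = int_poly_at z (RS_cf cs $ 2)"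
  \<comment> \<open>\<open>M_q (k + 1)\<close> is one \<open>rot\<close> followed by
    \<open>k\<close> applications of \<open>shear\<close>, each of which raises the index by
    one.\<close>
  have "P (int_poly_at z (q_int (Suc k)) * x - z ^ k * y) x" for k
  proof (induction k)
    case 0
    then show ?case using rot[of x y] Cons by (simp add: x_def y_def q_int_eq_sum)
  next
    case (Suc k)
    have "z * (int_poly_at z (q_int (Suc k)) * x - z ^ k * y) + x
        = int_poly_at z (q_int (Suc (Suc k))) * x - z ^ Suc k * y"
      unfolding q_int_Suc[of "Suc k"] by (simp add: algebra_simps)
    then show ?case using shear[OF Suc] by simp
  qed
  from this[of "c - 1"] show ?case
    using Cons.prems by (simp add: x_def y_def)
qed

text \<open>Six vectors are closed under both maps at \<open>z = -1\<close>; their second entries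
  are 0, 1 or -1.\<close>

lemma RS_cf_at_minus_1:
  assumes "\<forall>c \<in> set cs. 2 \<le> c"
  shows "\<bar>poly (RS_cf cs $ 2) (- 1)\<bar> \<le> 1"
proof -
  define P where
    "P x y \<longleftrightarrow> (x, y) \<in> {(1,0),(-1,0),(0,1),(0,-1),(1,1),(-1,-1)}" for x y :: int
  have "P (int_poly_at (-1) (RS_cf cs $ 1)) (int_poly_at (-1) (RS_cf cs $ 2))"
    by (rule RS_cf_invariant[where P = P, OF _ _ _ assms]) (auto simp: P_def)
  then show ?thesis
    using int_poly_at_of_int[of "-1" "RS_cf cs $ 2", where 'a = int] by (auto simp: P_def)
qed

text \<open>\<open>L\<close> lists vectors up to scalars of modulus one, and \<open>U\<close> the
  scalars met when a map is applied to a representative. They do not affect the modulus of the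
  second entry, so only \<open>L\<close> has to be checked.\<close>

lemma RS_cf_finite_orbit:
  fixes z :: complex and L :: "(complex \<times> complex) set"
  assumes base: "(1, 0) \<in> L"
    and U: "\<forall>v \<in> U. cmod v = 1"
    and shear: "\<forall>w \<in> L. \<exists>v \<in> U. \<exists>w' \<in> L. z * fst w + snd w = v * fst w' \<and> snd w = v * snd w'"
    and rot: "\<forall>w \<in> L. \<exists>v \<in> U. \<exists>w' \<in> L. fst w - snd w = v * fst w' \<and> fst w = v * snd w'"
    and cs: "\<forall>c \<in> set cs. 2 \<le> c"
  shows "\<exists>w \<in> L. cmod (int_poly_at z (RS_cf cs $ 2)) = cmod (snd w)"
proof -
  define P where
    "P x y \<longleftrightarrow> (\<exists>w \<in> L. \<exists>u. cmod u = 1 \<and> x = u * fst w \<and> y = u * snd w)" for x y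
  have "P (int_poly_at z (RS_cf cs $ 1)) (int_poly_at z (RS_cf cs $ 2))"
  proof (rule RS_cf_invariant[OF _ _ _ cs])
    show "P 1 0" using base by (auto simp: P_def intro!: bexI[of _ "(1, 0)"] exI[of _ 1])
  next
    fix x y assume "P x y"
    then obtain u w where u: "cmod u = 1" "x = u * fst w" "y = u * snd w" and w: "w \<in> L"
      by (auto simp: P_def)
    obtain v w' where v: "v \<in> U" "w' \<in> L" "z * fst w + snd w = v * fst w'" "snd w = v * snd w'"
      using bspec[OF shear w] by blast
    have "cmod (u * v) = 1" using u v U by (simp add: norm_mult)
    have "z * x + y = u * (z * fst w + snd w)" by (simp add: u algebra_simps)
    then have "z * x + y = u * v * fst w'" unfolding v(3) by simp
    moreover have "y = u * v * snd w'" by (simp add: u v)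
    ultimately show "P (z * x + y) y"
      unfolding P_def using \<open>w' \<in> L\<close> \<open>cmod (u * v) = 1\<close> by blast
  next
    fix x y assume "P x y"
    then obtain u w where u: "cmod u = 1" "x = u * fst w" "y = u * snd w" and w: "w \<in> L"
      by (auto simp: P_def)
    obtain v w' where v: "v \<in> U" "w' \<in> L" "fst w - snd w = v * fst w'" "fst w = v * snd w'"
      using bspec[OF rot w] by blast
    have "cmod (u * v) = 1" using u v U by (simp add: norm_mult)
    have "x - y = u * (fst w - snd w)" by (simp add: u algebra_simps)
    then have "x - y = u * v * fst w'" unfolding v(3) by simp
    moreover have "x = u * v * snd w'" by (simp add: u v)
    ultimately show "P (x - y) x"
      unfolding P_def using \<open>w' \<in> L\<close> \<open>cmod (u * v) = 1\<close> by blast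
  qed
  then obtain u w where "w \<in> L" "cmod u = 1" "int_poly_at z (RS_cf cs $ 2) = u * snd w"
    unfolding P_def by blast
  then show ?thesis by (intro bexI[of _ w]) (simp_all add: norm_mult)
qed

text \<open>Six representatives are closed up to powers of \<i>. Norm 2 comes from the entry
  \<open>1 + \<i>\<close>.\<close>

lemma RS_cf_at_i:
  assumes "\<forall>c \<in> set cs. 2 \<le> c"
  shows "(cmod (int_poly_at \<i> (RS_cf cs $ 2)))\<^sup>2 \<in> {0, 1, 2}"
proof -
  have "\<exists>w \<in> {(1,0), (0,1), (1,1), (1 + \<i>, 1), (\<i>, 1), (\<i>, 1 + \<i>)}.
      cmod (int_poly_at \<i> (RS_cf cs $ 2)) = cmod (snd w)"
    by (rule RS_cf_finite_orbit[where U = "{1, \<i>, -1}", OF _ _ _ _ assms])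
      (simp_all only: ball_simps bex_simps fst_conv snd_conv, simp_all add: complex_eq_iff)
  then obtain w where "w \<in> {(1,0), (0,1), (1,1), (1 + \<i>, 1), (\<i>, 1), (\<i>, 1 + \<i>)}"
    "(cmod (int_poly_at \<i> (RS_cf cs $ 2)))\<^sup>2 = (cmod (snd w))\<^sup>2"
    by metis
  moreover from this(1) have "(cmod (snd w))\<^sup>2 \<in> {0, 1, 2}"
    by (auto simp: cmod_power2)
  ultimately show ?thesis by simp
qed

definition \<omega> :: complex where "\<omega> = Complex (- 1 / 2) (sqrt 3 / 2)"

lemma Re_\<omega> [simp]: "Re \<omega> = - 1 / 2" and Im_\<omega> [simp]: "Im \<omega> = sqrt 3 / 2"
  by (simp_all add: \<omega>_def)

lemma \<omega>_squared: "\<omega> * (\<omega> * z) = - z - \<omega> * z"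
proof -
  have "\<omega> * \<omega> = - 1 - \<omega>" by (simp add: complex_eq_iff)
  then have "\<omega> * \<omega> * z = (- 1 - \<omega>) * z" by simp
  then show ?thesis by (simp add: algebra_simps)
qed

text \<open>Here four representatives suffice. The scalar \<open>1 + \<omega>\<close> equals
  \<open>- \<omega>^2\<close>, a sixth root of unity.\<close>

lemma RS_cf_at_\<omega>:
  assumes "\<forall>c \<in> set cs. 2 \<le> c"
  shows "(cmod (int_poly_at \<omega> (RS_cf cs $ 2)))\<^sup>2 \<in> {0, 1}"
proof -
  have "\<exists>w \<in> {(1,0), (0,1), (1,1), (1 + \<omega>, 1)}.
      cmod (int_poly_at \<omega> (RS_cf cs $ 2)) = cmod (snd w)"
    by (rule RS_cf_finite_orbit[where U = "{1, \<omega>, -1, 1 + \<omega>}", OF _ _ _ _ assms])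
      (simp_all only: ball_simps bex_simps fst_conv snd_conv,
        simp_all add: complex_eq_iff cmod_def power2_eq_square)
  then show ?thesis by auto
qed

text \<open>Reduction modulo the prime \<open>1 - \<i>\<close> above 2 sends \<i> to 1, so
  \<open>f(\<i>)\<close> and \<open>f(1)\<close> have the same residue; \<open>m\<close> witnesses
  this congruence.\<close>

lemma int_poly_at_i:
  "\<exists>x y m. int_poly_at \<i> f = of_int x + of_int y * \<i> \<and> poly f 1 = x + y + 2 * m"
proof (induction f)
  case 0
  show ?case by (intro exI[of _ 0]) simp
next
  case (pCons a f)
  then obtain x y m where "int_poly_at \<i> f = of_int x + of_int y * \<i>" "poly f 1 = x + y + 2 * m"
    by blast
  then have "int_poly_at \<i> (pCons a f) = of_int (a - y) + of_int x * \<i> \<and>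
      poly (pCons a f) 1 = a - y + x + 2 * (y + m)"
    by (simp add: algebra_simps)
  then show ?case by blast
qed

text \<open>Likewise, modulo the prime \<open>1 - \<omega>\<close> above 3.\<close>

lemma int_poly_at_\<omega>:
  "\<exists>x y m. int_poly_at \<omega> f = of_int x + of_int y * \<omega> \<and> poly f 1 = x + y + 3 * m"
proof (induction f)
  case 0
  show ?case by (intro exI[of _ 0]) simp
next
  case (pCons a f)
  then obtain x y m where "int_poly_at \<omega> f = of_int x + of_int y * \<omega>" "poly f 1 = x + y + 3 * m"
    by blast
  then have "int_poly_at \<omega> (pCons a f) = of_int (a - y) + of_int (x - y) * \<omega> \<and>
      poly (pCons a f) 1 = a - y + (x - y) + 3 * (y + m)"
    using \<omega>_squared[of "of_int y"] by (simp add: algebra_simps)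
  then show ?case by blast
qed

section \<open>Norms of Gaussian and Eisenstein integers\<close>

lemma cmod_gaussian: "(cmod (of_int x + of_int y * \<i>))\<^sup>2 = of_int (x\<^sup>2 + y\<^sup>2)"
  by (simp add: cmod_power2)

lemma cmod_eisenstein: "(cmod (of_int x + of_int y * \<omega>))\<^sup>2 = of_int (x\<^sup>2 - x * y + y\<^sup>2)"
  unfolding cmod_power2 by (simp add: power2_eq_square field_simps)

text \<open>Serves for squared moduli, which are multiplicative and integral on these rings: a
  factor of a value of norm one has norm one.\<close>

lemma unit_norms:
  fixes x y :: real
  assumes "x \<in> \<int>" "y \<in> \<int>" "0 \<le> x" "x * y = 1"
  shows "x = 1"
proof -
  obtain m n where mn: "x = of_int m" "y = of_int n" using assms by (auto elim!: Ints_cases)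
  then have "m * n = 1" "0 \<le> m" using assms by (metis of_int_eq_1_iff of_int_mult, simp)
  then show ?thesis using mn by (auto simp: zmult_eq_1_iff)
qed

lemma norm_i_in_Ints: "(cmod (int_poly_at \<i> f))\<^sup>2 \<in> \<int>"
proof -
  obtain x y m where "int_poly_at \<i> f = of_int x + of_int y * \<i>"
    using int_poly_at_i[of f] by blast
  then show ?thesis by (simp only: cmod_gaussian Ints_of_int)
qed

lemma norm_\<omega>_in_Ints: "(cmod (int_poly_at \<omega> f))\<^sup>2 \<in> \<int>"
proof -
  obtain x y m where "int_poly_at \<omega> f = of_int x + of_int y * \<omega>"
    using int_poly_at_\<omega>[of f] by blast
  then show ?thesis by (simp only: cmod_eisenstein Ints_of_int)
qed

lemma dvd_unit_at_i:
  assumes "cmod (int_poly_at \<i> (f * g)) = 1"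
  shows "cmod (int_poly_at \<i> f) = 1"
proof -
  have "(cmod (int_poly_at \<i> f))\<^sup>2 * (cmod (int_poly_at \<i> g))\<^sup>2 = 1"
    using assms by (simp add: norm_mult flip: power_mult_distrib)
  then have "(cmod (int_poly_at \<i> f))\<^sup>2 = 1"
    by (intro unit_norms[OF norm_i_in_Ints norm_i_in_Ints]) auto
  then show ?thesis by (simp add: power2_eq_1_iff) (smt (verit) norm_ge_zero)
qed

lemma dvd_unit_at_\<omega>:
  assumes "cmod (int_poly_at \<omega> (f * g)) = 1"
  shows "cmod (int_poly_at \<omega> f) = 1"
proof -
  have "(cmod (int_poly_at \<omega> f))\<^sup>2 * (cmod (int_poly_at \<omega> g))\<^sup>2 = 1"
    using assms by (simp add: norm_mult flip: power_mult_distrib)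
  then have "(cmod (int_poly_at \<omega> f))\<^sup>2 = 1"
    by (intro unit_norms[OF norm_\<omega>_in_Ints norm_\<omega>_in_Ints]) auto
  then show ?thesis by (simp add: power2_eq_1_iff) (smt (verit) norm_ge_zero)
qed

text \<open>Values at 1 and -1 have equal parity, which excludes 0.\<close>

lemma RS_cf_unit_at_minus_1:
  assumes "\<forall>c \<in> set cs. 2 \<le> c" "odd (poly (RS_cf cs $ 2) 1)"
  shows "\<bar>poly (RS_cf cs $ 2) (- 1)\<bar> = 1"
proof -
  have "even (poly f 1 - poly f (- 1))" for f :: "int poly"
    by (induction f) auto
  from this[of "RS_cf cs $ 2"] have "odd (poly (RS_cf cs $ 2) (- 1))" using assms(2) by simp
  then have "poly (RS_cf cs $ 2) (- 1) \<noteq> 0" by (metis even_zero)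
  then show ?thesis using RS_cf_at_minus_1[OF assms(1)] by linarith
qed

text \<open>The norm \<open>x^2 + y^2\<close> has the parity of \<open>x + y\<close>, hence of
  \<open>S(1)\<close>, which excludes 0 and 2.\<close>

lemma RS_cf_unit_at_i:
  assumes "\<forall>c \<in> set cs. 2 \<le> c" "odd (poly (RS_cf cs $ 2) 1)"
  shows "cmod (int_poly_at \<i> (RS_cf cs $ 2)) = 1"
proof -
  obtain x y m where xy: "int_poly_at \<i> (RS_cf cs $ 2) = of_int x + of_int y * \<i>"
    "poly (RS_cf cs $ 2) 1 = x + y + 2 * m"
    using int_poly_at_i by blast
  then have "odd (x\<^sup>2 + y\<^sup>2)" using assms(2) by simp
  then have "x\<^sup>2 + y\<^sup>2 \<noteq> 0" "x\<^sup>2 + y\<^sup>2 \<noteq> 2" by (metis even_zero, metis even_numeral)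
  moreover have "real_of_int (x\<^sup>2 + y\<^sup>2) \<in> {0, 1, 2}"
    using RS_cf_at_i[OF assms(1)] unfolding xy cmod_gaussian .
  then have "x\<^sup>2 + y\<^sup>2 \<in> {0, 1, 2}"
    unfolding insert_iff by (simp del: of_int_add of_int_power)
  ultimately have "x\<^sup>2 + y\<^sup>2 = 1" by blast
  then have "(cmod (int_poly_at \<i> (RS_cf cs $ 2)))\<^sup>2 = 1"
    unfolding xy cmod_gaussian by (simp only: of_int_1)
  then show ?thesis by (simp add: power2_eq_1_iff) (smt (verit) norm_ge_zero)
qed

text \<open>A zero at \<omega> means \<open>x = y = 0\<close>, and then 3 divides
  \<open>S(1)\<close>.\<close>

lemma RS_cf_unit_at_\<omega>:
  assumes "\<forall>c \<in> set cs. 2 \<le> c" "\<not> 3 dvd poly (RS_cf cs $ 2) 1"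
  shows "cmod (int_poly_at \<omega> (RS_cf cs $ 2)) = 1"
proof -
  obtain x y m where xy: "int_poly_at \<omega> (RS_cf cs $ 2) = of_int x + of_int y * \<omega>"
    "poly (RS_cf cs $ 2) 1 = x + y + 3 * m"
    using int_poly_at_\<omega> by blast
  have "int_poly_at \<omega> (RS_cf cs $ 2) \<noteq> 0"
  proof
    assume "int_poly_at \<omega> (RS_cf cs $ 2) = 0"
    then have "y = 0" "x = 0" using xy(1) by (auto simp: complex_eq_iff)
    then show False using assms(2) xy(2) by simp
  qed
  then have "(cmod (int_poly_at \<omega> (RS_cf cs $ 2)))\<^sup>2 = 1"
    using RS_cf_at_\<omega>[OF assms(1)] by auto
  then show ?thesis by (simp add: power2_eq_1_iff) (smt (verit) norm_ge_zero)
qed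

section \<open>Divisors of small degree\<close>

text \<open>The triples \<open>(degree f, f(1), f(2))\<close> of the monic polynomials \<open>f\<close> of degree between 1 and 6
  with \<open>f(0) = 1\<close> that take unit values at \<open>- 1\<close>, \<open>\<i>\<close> and \<open>\<omega>\<close>.\<close>

definition small_values :: "(nat \<times> int \<times> int) list" where
  "small_values = [
    (3,5,17), (3,5,19), (4,5,31), (4,7,37), (4,7,43), (4,11,59), (5,5,47), (5,5,61), (5,7,67),
    (5,7,71), (5,11,89), (5,11,97), (5,11,101), (5,11,103), (5,13,107), (5,13,109), (5,13,113),
    (5,13,121), (5,17,139), (5,17,143), (5,19,149), (5,19,163), (6,7,127), (6,11,157), (6,11,187),
    (6,13,169), (6,13,197), (6,13,211), (6,17,199), (6,17,227), (6,17,229), (6,17,241), (6,17,257),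
    (6,17,271), (6,19,239), (6,19,247), (6,19,253), (6,19,277), (6,19,281), (6,23,269), (6,23,283),
    (6,23,299), (6,23,307), (6,23,311), (6,23,313), (6,23,341), (6,25,289), (6,25,317), (6,25,319),
    (6,25,323), (6,25,331), (6,25,347), (6,25,361), (6,29,349), (6,29,353), (6,29,377), (6,29,383),
    (6,29,391), (6,31,359), (6,31,373), (6,31,389), (6,31,401), (6,31,403), (6,31,431), (6,35,419),
    (6,35,433), (6,35,461), (6,37,443), (6,37,473), (6,41,503)]"

definition monic_of_degree :: "nat \<Rightarrow> int list \<Rightarrow> bool" where
  "monic_of_degree d cs \<longleftrightarrow> cs ! d = 1 \<and> list_all (\<lambda>c. c = 0) (drop (Suc d) cs)"

text \<open>The formulas for the coefficients solve the linear system
  \<open>f(- 1) = e\<close>, \<open>f(\<i>) = x + y \<i>\<close>, \<open>f(\<omega>) = u + v \<omega>\<close>.\<close>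

lemma small_values_check:
  "\<forall>e \<in> set [1, -1]. \<forall>(x, y) \<in> set [(1,0), (-1,0), (0,1), (0,-1)].
    \<forall>(u, v) \<in> set [(1,0), (-1,0), (0,1), (0,-1), (1,1), (-1,-1)].
    \<forall>c6 \<in> set [0, 1]. \<forall>d \<in> set [1..<7].
    let h = (x + y - e) div 2; c5 = 1 + 2 * c6 + h - y - u; c2 = v + 1 - x - h - 2 * c6 + 2 * c5;
      c1 = c2 + c6 - c5 + h; c3 = c1 + c5 - y; c4 = x - 1 + c2 + c6
    in monic_of_degree d [1, c1, c2, c3, c4, c5, c6] \<longrightarrow>
      (d, 1 + c1 + c2 + c3 + c4 + c5 + c6,
        1 + 2 * c1 + 4 * c2 + 8 * c3 + 16 * c4 + 32 * c5 + 64 * c6) \<in> set small_values"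
  by code_simp

text \<open>Five linear conditions on six coefficients leave \<open>c6\<close> free, and a monic
  polynomial of degree at most 6 has \<open>c6\<close> equal to 0 or 1. The proof recovers the
  formulas of \<open>small_values_check\<close>.\<close>

lemma small_values_coeffs:
  fixes c1 c2 c3 c4 c5 c6 e x y u v :: int
  assumes e: "1 - c1 + c2 - c3 + c4 - c5 + c6 = e" "e \<in> {1, -1}"
    and xy: "1 - c2 + c4 - c6 = x" "c1 - c3 + c5 = y"
      "(x, y) \<in> {(1,0), (-1,0), (0,1), (0,-1)}"
    and uv: "1 - c2 + c3 - c5 + c6 = u" "c1 - c2 + c4 - c5 = v"
      "(u, v) \<in> {(1,0), (-1,0), (0,1), (0,-1), (1,1), (-1,-1)}"
    and d: "c6 \<in> {0, 1}" "d \<in> {1..<7}" "monic_of_degree d [1, c1, c2, c3, c4, c5, c6]"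
  shows "(d, 1 + c1 + c2 + c3 + c4 + c5 + c6,
    1 + 2 * c1 + 4 * c2 + 8 * c3 + 16 * c4 + 32 * c5 + 64 * c6) \<in> set small_values"
proof -
  \<comment> \<open>In \<open>x + y - e\<close> all terms cancel or double, so the halving is
    exact.\<close>
  define h where "h = c1 - c2 + c5 - c6"
  have "2 * h = x + y - e" unfolding h_def e(1)[symmetric] xy(1,2)[symmetric] by simp
  then have h: "(x + y - e) div 2 = h" by simp
  have c5: "1 + 2 * c6 + h - y - u = c5" using xy(1,2) uv(1,2) unfolding h_def by linarith
  have c2: "v + 1 - x - h - 2 * c6 + 2 * c5 = c2" using xy(1,2) uv(1,2) unfolding h_def by linarith
  have c1: "c2 + c6 - c5 + h = c1" by (simp add: h_def)
  have c3: "c1 + c5 - y = c3" and c4: "x - 1 + c2 + c6 = c4" using xy by auto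
  have "e \<in> set [1, -1]" "(x, y) \<in> set [(1,0), (-1,0), (0,1), (0,-1)]"
    "(u, v) \<in> set [(1,0), (-1,0), (0,1), (0,-1), (1,1), (-1,-1)]" "c6 \<in> set [0, 1]"
    "d \<in> set [1..<7]"
    using e(2) xy(3) uv(3) d(1,2) by simp_all
  note small_values_check[THEN bspec, OF this(1), THEN bspec, OF this(2), unfolded prod.case,
      THEN bspec, OF this(3), unfolded prod.case, THEN bspec, OF this(4), THEN bspec, OF this(5)]
  then show ?thesis using d(3) unfolding Let_def h c5 c2 c1 c3 c4 by blast
qed

lemma unit_norm_gaussian:
  fixes x y :: int
  assumes "x\<^sup>2 + y\<^sup>2 = 1"
  shows "(x, y) \<in> {(1,0), (-1,0), (0,1), (0,-1)}"
proof -
  have "x\<^sup>2 \<le> 1" "y\<^sup>2 \<le> 1" using assms zero_le_power2[of x] zero_le_power2[of y] by linarith+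
  then have "\<bar>x\<bar> \<le> 1" "\<bar>y\<bar> \<le> 1" using abs_le_square_iff[of x 1] abs_le_square_iff[of y 1] by simp_all
  then have "x \<in> {-1, 0, 1}" "y \<in> {-1, 0, 1}" by auto
  then show ?thesis using assms by auto
qed

text \<open>Completing the square in either variable bounds the other by one in absolute
  value.\<close>

lemma unit_norm_eisenstein:
  fixes x y :: int
  assumes "x\<^sup>2 - x * y + y\<^sup>2 = 1"
  shows "(x, y) \<in> {(1,0), (-1,0), (0,1), (0,-1), (1,1), (-1,-1)}"
proof -
  have "(2 * x - y)\<^sup>2 + 3 * y\<^sup>2 = 4" "(2 * y - x)\<^sup>2 + 3 * x\<^sup>2 = 4"
    using assms by (simp_all add: power2_eq_square algebra_simps)
  then have "x\<^sup>2 \<le> 1" "y\<^sup>2 \<le> 1"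
    using zero_le_power2[of "2 * x - y"] zero_le_power2[of "2 * y - x"] by linarith+
  then have "\<bar>x\<bar> \<le> 1" "\<bar>y\<bar> \<le> 1" using abs_le_square_iff[of x 1] abs_le_square_iff[of y 1] by simp_all
  then have "x \<in> {-1, 0, 1}" "y \<in> {-1, 0, 1}" by auto
  then show ?thesis using assms by auto
qed

text \<open>The three rings have finitely many units, so the unit values are linear conditions on
  the coefficients with finitely many right-hand sides.\<close>

lemma small_values_poly:
  fixes f :: "int poly"
  assumes deg: "1 \<le> degree f" "degree f \<le> 6"
    and lc: "lead_coeff f = 1" "coeff f 0 = 1"
    and m1: "\<bar>poly f (- 1)\<bar> = 1"
    and i: "cmod (int_poly_at \<i> f) = 1"
    and w: "cmod (int_poly_at \<omega> f) = 1"
  shows "(degree f, poly f 1, poly f 2) \<in> set small_values"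
proof -
  obtain c1 c2 c3 c4 c5 c6 where c: "coeff f 1 = c1" "coeff f 2 = c2" "coeff f 3 = c3"
    "coeff f 4 = c4" "coeff f 5 = c5" "coeff f 6 = c6" by blast
  have f: "f = [:1, c1, c2, c3, c4, c5, c6:]"
  proof (rule poly_eqI)
    fix n
    consider "n = 0" | "n = 1" | "n = 2" | "n = 3" | "n = 4" | "n = 5" | "n = 6" | "degree f < n"
      using deg by linarith
    then show "coeff f n = coeff [:1, c1, c2, c3, c4, c5, c6:] n"
      using lc deg c
      by cases (auto simp: coeff_pCons coeff_eq_0 numeral_eq_Suc split: nat.split)
  qed
  have "int_poly_at \<i> f
      = of_int (1 - c2 + c4 - c6) + of_int (c1 - c3 + c5) * \<i>"
    by (simp add: f complex_eq_iff)
  then have "(cmod (int_poly_at \<i> f))\<^sup>2 = of_int ((1 - c2 + c4 - c6)\<^sup>2 + (c1 - c3 + c5)\<^sup>2)"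
    by (simp only: cmod_gaussian)
  then have "(1 - c2 + c4 - c6)\<^sup>2 + (c1 - c3 + c5)\<^sup>2 = 1" using i by (metis of_int_eq_1_iff one_power2)
  note 1 = unit_norm_gaussian[OF this]
  have "int_poly_at \<omega> f
      = of_int (1 - c2 + c3 - c5 + c6) + of_int (c1 - c2 + c4 - c5) * \<omega>"
    by (simp add: f complex_eq_iff field_simps)
  then have "(cmod (int_poly_at \<omega> f))\<^sup>2 = of_int ((1 - c2 + c3 - c5 + c6)\<^sup>2
      - (1 - c2 + c3 - c5 + c6) * (c1 - c2 + c4 - c5) + (c1 - c2 + c4 - c5)\<^sup>2)"
    by (simp only: cmod_eisenstein)
  then have "(1 - c2 + c3 - c5 + c6)\<^sup>2
      - (1 - c2 + c3 - c5 + c6) * (c1 - c2 + c4 - c5) + (c1 - c2 + c4 - c5)\<^sup>2 = 1"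
    using w by (metis of_int_eq_1_iff one_power2)
  note 2 = unit_norm_eisenstein[OF this]
  have 3: "1 - c1 + c2 - c3 + c4 - c5 + c6 \<in> {1, -1}" using m1 by (auto simp: f)
  have z: "coeff f n = 0" if "degree f < n" for n using that by (rule coeff_eq_0)
  have "degree f = 1 \<or> degree f = 2 \<or> degree f = 3 \<or> degree f = 4 \<or> degree f = 5 \<or> degree f = 6"
    using deg by linarith
  then have "monic_of_degree (degree f) [1, c1, c2, c3, c4, c5, c6]" "c6 \<in> {0, 1}"
    using lc(1) z[of 2] z[of 3] z[of 4] z[of 5] z[of 6] unfolding c[symmetric]
    by (auto simp: monic_of_degree_def)
  moreover have "degree f \<in> {1..<7}" using deg by simp
  ultimately have "(degree f, 1 + c1 + c2 + c3 + c4 + c5 + c6,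
      1 + 2 * c1 + 4 * c2 + 8 * c3 + 16 * c4 + 32 * c5 + 64 * c6) \<in> set small_values"
    using small_values_coeffs[OF refl 3 refl refl 1 refl refl 2] by blast
  moreover have "poly f 1 = 1 + c1 + c2 + c3 + c4 + c5 + c6"
    "poly f 2 = 1 + 2 * c1 + 4 * c2 + 8 * c3 + 16 * c4 + 32 * c5 + 64 * c6"
    by (simp_all add: f)
  ultimately show ?thesis by simp
qed

section \<open>Evaluation at two\<close>

text \<open>Executable values of \<open>R\<close> and \<open>S\<close> at 2 for
  \<open>m / n\<close>. The ceiling \<open>c\<close> of \<open>m / n\<close> is the first entry of
  the expansion, \<open>2 ^ c - 1\<close> is \<open>q_int c\<close> at 2, and \<open>n = 0\<close>
  stands for the empty expansion.\<close>

function eval_at_2 :: "nat \<Rightarrow> nat \<Rightarrow> int \<times> int" where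
  "eval_at_2 m n = (if n = 0 then (1, 0) else
     let c = (m + n - 1) div n; (r, s) = eval_at_2 n (c * n - m)
     in ((2 ^ c - 1) * r - 2 ^ (c - 1) * s, r))"
  by auto
termination
proof (relation "measure snd")
  fix m n c :: nat
  assume "n \<noteq> 0" "c = (m + n - 1) div n"
  moreover from this have "c * n \<le> m + n - 1" by simp
  ultimately have "c * n - m < n" by linarith
  then show "((n, c * n - m), (m, n)) \<in> measure snd" by simp
qed simp

declare eval_at_2.simps [simp del]

text \<open>Removing the first entry \<open>c\<close> from \<open>m / n\<close> leaves
  \<open>n / (c * n - m)\<close>; if no entry remains, this denominator is 0 and the base case
  applies.\<close>

lemma eval_at_2_RS_cf:
  assumes "\<forall>c \<in> set cs. 2 \<le> c" "cs \<noteq> []" "0 < n" "neg_cf cs = of_nat m / of_nat n"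
  shows "eval_at_2 m n = (poly (RS_cf cs $ 1) 2, poly (RS_cf cs $ 2) 2)"
  using assms
proof (induction cs arbitrary: m n)
  case (Cons c cs)
  have c: "2 \<le> c" using Cons.prems by simp
  have q: "poly (q_int c) 2 = 2 ^ c - (1 :: int)" for c
    by (induction c) (simp_all add: q_int_eq_sum poly_monom)
  have ceil: "\<lceil>of_nat m / of_nat n :: rat\<rceil> = int c"
    using neg_cf_ceiling[OF Cons.prems(1)] Cons.prems(4) by simp
  have "(of_nat m :: rat) \<le> of_nat (c * n)" "(of_nat (c * n) :: rat) < of_nat (m + n)"
    using ceil \<open>0 < n\<close> by (simp_all add: ceiling_eq_iff field_simps)
  then have mn: "m \<le> c * n" "c * n < m + n" unfolding of_nat_le_iff of_nat_less_iff .
  have "(m + n - 1) div n = c"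
    using mn \<open>0 < n\<close> by (intro div_nat_eqI) (auto simp: algebra_simps)
  then have rec: "eval_at_2 m n = (let (r, s) = eval_at_2 n (c * n - m)
      in ((2 ^ c - 1) * r - 2 ^ (c - 1) * s, r))"
    using \<open>0 < n\<close> by (subst eval_at_2.simps) (simp add: Let_def)
  have "eval_at_2 n (c * n - m) = (poly (RS_cf cs $ 1) 2, poly (RS_cf cs $ 2) 2)"
  proof (cases cs)
    case Nil
    then have "(of_nat m :: rat) = of_nat (c * n)"
      using Cons.prems by (simp add: field_simps)
    then have "m = c * n" unfolding of_nat_eq_iff .
    then show ?thesis using Nil by (simp add: eval_at_2.simps)
  next
    case (Cons d ds)
    have gt: "1 < neg_cf cs" using Cons.prems Cons by (intro neg_cf_gt_1) auto
    have "1 / neg_cf cs = of_nat c - of_nat m / of_nat n"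
      using Cons.prems Cons by simp
    also have "\<dots> = of_nat (c * n - m) / of_nat n"
      using mn \<open>0 < n\<close> by (simp add: of_nat_diff field_simps)
    finally have eq: "1 / neg_cf cs = of_nat (c * n - m) / of_nat n" .
    then have "neg_cf cs = of_nat n / of_nat (c * n - m)"
      by (metis divide_divide_eq_right mult_1 div_by_1)
    moreover have "0 < c * n - m"
      using eq gt by (cases "c * n - m = 0") auto
    ultimately show ?thesis using Cons.IH Cons.prems Cons by simp
  qed
  then show ?case by (simp add: rec q poly_monom)
qed simp

text \<open>\<open>S\<close> is the first component for the tail of the expansion, so the first
  entry drops out. The witness \<open>c * p - m\<close> is the residue of \<open>- a\<close> modulo
  \<open>p\<close>; hence \<open>p\<close> evaluations cover all \<open>a\<close>.\<close>

lemma q_denom_at_2: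
  assumes "0 < p"
  shows "\<exists>r < p. poly (q_denom (of_int a / of_nat p)) 2 = fst (eval_at_2 p r)"
proof -
  obtain k cs where cs: "is_neg_cf_expansion (of_int a / of_nat p + of_nat k) cs"
    and S: "q_denom (of_int a / of_nat p) = RS_cf cs $ 2"
    using q_denom_eq_RS_cf by blast
  define m where "m = nat (a + int k * int p)"
  have "(1 :: rat) < of_int a / of_nat p + of_nat k"
    using cs neg_cf_gt_1 unfolding is_neg_cf_expansion_def by metis
  also have eq: "(of_int a / of_nat p + of_nat k :: rat) = of_int (a + int k * int p) / of_nat p"
    using assms by (simp add: field_simps)
  finally have "(of_nat p :: rat) < of_int (a + int k * int p)"
    using assms by (simp add: field_simps)
  then have "0 < a + int k * int p" by (metis less_trans of_int_0_less_iff of_nat_0_less_iff assms)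
  then have "(of_int a / of_nat p + of_nat k :: rat) = of_nat m / of_nat p"
    unfolding eq m_def by simp
  then have "eval_at_2 m p = (poly (RS_cf cs $ 1) 2, poly (RS_cf cs $ 2) 2)"
    using cs assms by (intro eval_at_2_RS_cf) (auto simp: is_neg_cf_expansion_def)
  moreover define c where "c = (m + p - 1) div p"
  moreover have "snd (eval_at_2 m p) = fst (eval_at_2 p (c * p - m))"
    unfolding c_def using assms
    by (subst eval_at_2.simps) (simp add: Let_def split: prod.split)
  moreover have "c * p \<le> m + p - 1" by (simp add: c_def)
  then have "c * p - m < p" using assms by linarith
  ultimately show ?thesis using S by auto
qed

text \<open>25 and 35 are the composite values of \<open>f(1)\<close> in the list, impossible once
  \<open>f(1) = p\<close>. The 7 in the exponent is the least degree of the cofactor.\<close>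

lemma small_values_not_dvd:
  "\<forall>(d, p, v) \<in> set small_values. p \<noteq> 25 \<longrightarrow> p \<noteq> 35 \<longrightarrow>
     (\<forall>r \<in> set [0..<nat p]. let s = fst (eval_at_2 (nat p) r) in v dvd s \<longrightarrow> s < 2 ^ (d + 7))"
  by code_simp

section \<open>Gauss's lemma\<close>

lemma ex_clear_denominators:
  fixes g :: "rat poly"
  shows "\<exists>a G. a \<noteq> 0 \<and> map_poly rat_of_int G = smult (of_int a) g"
proof (induction g)
  case 0
  show ?case by (intro exI[of _ 1] exI[of _ 0]) simp
next
  case (pCons x g)
  then obtain a G where a: "a \<noteq> 0" "map_poly rat_of_int G = smult (of_int a) g" by blast
  obtain m n :: int where mn: "x = of_int m / of_int n" "n \<noteq> 0"
    by (metis Fract_of_int_quotient Rat_cases less_irrefl)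
  have "map_poly rat_of_int (pCons (a * m) (smult n G)) = smult (of_int (a * n)) (pCons x g)"
    using mn by (simp add: map_poly_pCons map_poly_smult a(2) mult.commute)
  then show ?case using a mn by (metis mult_eq_0_iff)
qed

lemma map_poly_rat_of_int_eq_iff: "map_poly rat_of_int f = map_poly rat_of_int g \<longleftrightarrow> f = g"
  by (auto simp: poly_eq_iff coeff_map_poly)

text \<open>Clearing denominators gives \<open>G * H = a * b * S\<close>. A monic \<open>S\<close>
  has content 1, so the primitive parts multiply to \<open>S\<close> up to the sign
  \<open>k\<close>. Their leading coefficients, after absorbing \<open>k\<close>, are both 1 or both
  -1; in the latter case both factors are negated.\<close>

lemma gauss_rat_factor:
  fixes S :: "int poly" and g h :: "rat poly"
  assumes lc: "lead_coeff S = 1" and S: "map_poly rat_of_int S = g * h"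
  shows "\<exists>G H. S = G * H \<and> degree G = degree g \<and> degree H = degree h \<and>
    lead_coeff G = 1 \<and> lead_coeff H = 1"
proof -
  obtain a G where G: "a \<noteq> 0" "map_poly rat_of_int G = smult (of_int a) g"
    using ex_clear_denominators by blast
  obtain b H where H: "b \<noteq> 0" "map_poly rat_of_int H = smult (of_int b) h"
    using ex_clear_denominators by blast
  have "map_poly rat_of_int (G * H) = map_poly rat_of_int (smult (a * b) S)"
    using G H S by (simp add: map_poly_of_int_mult map_poly_smult mult.commute)
  then have GH: "G * H = smult (a * b) S" by (simp only: map_poly_rat_of_int_eq_iff)
  have "is_unit (content S)"
    using content_dvd_coeff[of S "degree S"] lc by simp
  then have cS: "content S = 1" by (metis is_unit_normalize normalize_content)
  define k where "k = sgn (a * b)"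
  have "content G * content H = \<bar>a * b\<bar>"
    using arg_cong[OF GH, of content] cS by (simp add: content_mult)
  moreover have "G * H = smult (content G * content H) (primitive_part G * primitive_part H)"
    by (metis content_times_primitive_part mult_smult_left mult_smult_right smult_smult)
  moreover have "a * b = \<bar>a * b\<bar> * k" by (simp add: k_def abs_mult_sgn)
  ultimately have "smult \<bar>a * b\<bar> (primitive_part G * primitive_part H) = smult \<bar>a * b\<bar> (smult k S)"
    using GH by (metis smult_smult)
  moreover have "\<bar>a * b\<bar> \<noteq> 0" using G H by simp
  ultimately have PP: "primitive_part G * primitive_part H = smult k S"
    unfolding poly_eq_iff by simp
  have k: "k = 1 \<or> k = -1" using G H by (auto simp: k_def sgn_if)
  have "degree (map_poly rat_of_int F) = degree F" for F by (simp add: degree_map_poly)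
  then have dG: "degree G = degree g" and dH: "degree H = degree h"
    using G H by (metis degree_smult_eq of_int_eq_0_iff)+
  define G' where "G' = smult k (primitive_part G)"
  have S': "S = G' * primitive_part H"
    using PP k by (auto simp: G'_def)
  have dG': "degree G' = degree g" using dG k by (auto simp: G'_def)
  have "lead_coeff G' * lead_coeff (primitive_part H) = 1"
    using lc S' by (metis lead_coeff_mult)
  then consider "lead_coeff G' = 1" "lead_coeff (primitive_part H) = 1"
    | "lead_coeff G' = -1" "lead_coeff (primitive_part H) = -1"
    by (auto simp: zmult_eq_1_iff)
  then show ?thesis
  proof cases
    case 1
    then show ?thesis using S' dG' dH by (metis degree_primitive_part)
  next
    case 2
    then have "lead_coeff (- G') = 1" "lead_coeff (- primitive_part H) = 1" by simp_all
    moreover have "S = (- G') * (- primitive_part H)" using S' by simp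
    ultimately show ?thesis using dG' dH by (metis degree_primitive_part degree_minus)
  qed
qed

section \<open>Positivity of the factors\<close>

text \<open>A monic polynomial is eventually positive, so a negative value at \<open>n\<close>
  yields a root beyond \<open>n\<close> by the intermediate value theorem.\<close>

lemma monic_pos_if_no_nonneg_root:
  fixes f :: "int poly"
  assumes "lead_coeff f = 1" and nz: "\<And>x::real. 0 \<le> x \<Longrightarrow> int_poly_at x f \<noteq> 0" and "0 \<le> n"
  shows "0 < poly f n"
proof (rule ccontr)
  define F where "F = map_poly real_of_int f"
  assume "\<not> 0 < poly f n"
  have at: "poly F (of_int n) = of_int (poly f n)"
    using int_poly_at_of_int[of n f, where 'a = real] by (simp add: int_poly_at_def F_def)
  with nz[of "of_int n"] \<open>\<not> 0 < poly f n\<close> \<open>0 \<le> n\<close> have neg: "poly F (of_int n) < 0"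
    by (simp add: int_poly_at_of_int)
  have "lead_coeff F = 1"
    using assms(1) by (simp add: F_def coeff_map_poly degree_map_poly)
  then obtain b where b: "\<forall>x \<ge> b. poly F x \<ge> 1" using poly_pinfty_gt_lc[of F] by auto
  define c where "c = max b (of_int n + 1)"
  have "poly F c > 0" using b[rule_format, of c] by (simp add: c_def)
  moreover have "of_int n < c" by (simp add: c_def)
  ultimately obtain x where "of_int n < x" "poly F x = 0"
    using poly_IVT_pos[of "of_int n" c F] neg by blast
  then show False using nz[of x] \<open>0 \<le> n\<close> by (simp add: int_poly_at_def F_def)
qed

text \<open>It follows that \<open>S\<close> has no nonnegative real root, which its factors inherit
  although the signs of their coefficients are unknown.\<close>

lemma nonneg_coeffs_at_pos:
  fixes x :: real
  assumes "nonneg_coeffs f" "coeff f 0 = 1" "0 \<le> x"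
  shows "0 < int_poly_at x f"
proof -
  have nn: "nonneg_coeffs g \<Longrightarrow> 0 \<le> int_poly_at x g" for g
  proof (induction g)
    case (pCons a g)
    have "0 \<le> a" using pCons.prems[unfolded nonneg_coeffs_def, rule_format, of 0] by simp
    moreover have "nonneg_coeffs g" unfolding nonneg_coeffs_def
    proof
      fix i show "0 \<le> coeff g i"
        using pCons.prems[unfolded nonneg_coeffs_def, rule_format, of "Suc i"] by simp
    qed
    ultimately show ?case using pCons.IH \<open>0 \<le> x\<close> by simp
  qed simp
  obtain a g where f: "f = pCons a g" by (cases f)
  then have "a = 1" using assms by simp
  moreover have "nonneg_coeffs g" unfolding nonneg_coeffs_def
  proof
    fix i show "0 \<le> coeff g i"
      using assms(1)[unfolded nonneg_coeffs_def, rule_format, of "Suc i"] f by simp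
  qed
  ultimately show ?thesis using nn f \<open>0 \<le> x\<close> by (simp add: add_pos_nonneg)
qed

lemma nonneg_coeffs_monic_ge_power:
  assumes "nonneg_coeffs f" "lead_coeff f = 1"
  shows "2 ^ degree f \<le> poly f 2"
proof -
  have "coeff f (degree f) * 2 ^ degree f \<le> (\<Sum>i\<le>degree f. coeff f i * 2 ^ i)"
    using assms(1) by (intro member_le_sum) (auto simp: nonneg_coeffs_def)
  then show ?thesis using assms(2) by (simp add: poly_altdef)
qed

section \<open>Exclusion of small factors\<close>

text \<open>Both \<open>r / s\<close> and \<open>b / p\<close> are the shifted fraction in lowest
  terms with positive denominator, whence \<open>S(1) = s = p\<close>.\<close>

lemma q_denom_properties:
  fixes p :: nat
  assumes "0 < p" "coprime a (int p)"
  defines "S \<equiv> q_denom (of_int a / of_nat p)"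
  shows "lead_coeff S = 1" "coeff S 0 = 1" "nonneg_coeffs S" "poly S 1 = int p"
    "odd p \<Longrightarrow> \<bar>poly S (- 1)\<bar> = 1" "odd p \<Longrightarrow> cmod (int_poly_at \<i> S) = 1"
    "\<not> 3 dvd p \<Longrightarrow> cmod (int_poly_at \<omega> S) = 1"
proof -
  obtain k cs where "is_neg_cf_expansion (of_int a / of_nat p + of_nat k) cs"
    and S: "S = RS_cf cs $ 2"
    using q_denom_eq_RS_cf unfolding S_def by blast
  then have cs: "\<forall>c \<in> set cs. 2 \<le> c" "cs \<noteq> []"
    and val: "neg_cf cs = of_int a / of_nat p + of_nat k"
    by (auto simp: is_neg_cf_expansion_def)
  obtain c cs' where cs': "cs = c # cs'" using cs by (cases cs) auto
  \<comment> \<open>\<open>S\<close> is the first component for the tail \<open>cs'\<close>.\<close>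
  show "lead_coeff S = 1" "coeff S 0 = 1"
    using RS_cf_monic[of cs'] cs cs' S by simp_all
  show "nonneg_coeffs S"
    using RS_cf_nonneg_coeffs[OF cs(1)] S by simp
  define r s where "r = poly (RS_cf cs $ 1) 1" and "s = poly (RS_cf cs $ 2) 1"
  have rs: "coprime r s" "0 < s" "neg_cf cs = of_int r / of_int s"
    using RS_cf_at_1[OF cs(1)] cs(2) by (auto simp: r_def s_def)
  define b where "b = a + int k * int p"
  have "coprime b (int p)"
  proof (rule coprimeI)
    fix d assume d: "d dvd b" "d dvd int p"
    then have "d dvd b - int k * int p" by (intro dvd_diff dvd_mult)
    also have "b - int k * int p = a" by (simp add: b_def)
    finally have "d dvd a" .
    with assms(2) show "is_unit d" using d(2) by (rule coprime_common_divisor)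
  qed
  have "(of_int r :: rat) / of_int s = of_int b / of_int (int p)"
    using val rs(3) assms(1) by (simp add: b_def field_simps)
  then have "of_int (r * int p) = (of_int (b * s) :: rat)"
    using rs(2) assms(1) by (simp add: field_simps)
  then have eq: "r * int p = b * s" unfolding of_int_eq_iff .
  have "s dvd int p"
    using eq rs(1) by (metis coprime_commute coprime_dvd_mult_right_iff dvd_triv_right)
  moreover have "int p dvd s"
    using eq \<open>coprime b (int p)\<close>
    by (metis coprime_commute coprime_dvd_mult_right_iff dvd_triv_right)
  ultimately have "s = int p" using rs(2) by (simp add: zdvd_antisym_nonneg)
  then show 1: "poly S 1 = int p" by (simp add: S s_def)
  have 3: "3 dvd int p \<longleftrightarrow> 3 dvd p" by (metis int_dvd_int_iff of_nat_numeral)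
  show "odd p \<Longrightarrow> \<bar>poly S (- 1)\<bar> = 1" "odd p \<Longrightarrow> cmod (int_poly_at \<i> S) = 1"
    "\<not> 3 dvd p \<Longrightarrow> cmod (int_poly_at \<omega> S) = 1"
    using RS_cf_unit_at_minus_1[OF cs(1)] RS_cf_unit_at_i[OF cs(1)] RS_cf_unit_at_\<omega>[OF cs(1)]
      1 3 unfolding S by simp_all
qed

lemma no_small_factor:
  fixes p :: nat and G H :: "int poly"
  assumes p: "prime p" and a: "coprime a (int p)"
    and GH: "q_denom (of_int a / of_nat p) = G * H"
    and lc: "lead_coeff G = 1" "lead_coeff H = 1"
    and deg: "1 \<le> degree G" "1 \<le> degree H"
  shows "7 \<le> degree G"
proof (rule ccontr)
  assume "\<not> 7 \<le> degree G"
  have p0: "0 < p" using p by (rule prime_gt_0_nat)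
  note S = q_denom_properties[OF p0 a, unfolded GH]
  have nz: "int_poly_at x G \<noteq> 0" "int_poly_at x H \<noteq> 0" if "0 \<le> x" for x :: real
    using nonneg_coeffs_at_pos[OF S(3,2) that] by auto
  have pos: "0 < poly G n" "0 < poly H n" if "0 \<le> n" for n
    using monic_pos_if_no_nonneg_root[OF lc(1) nz(1) that]
      monic_pos_if_no_nonneg_root[OF lc(2) nz(2) that] by auto
  have "coeff G 0 * coeff H 0 = 1" using S(2) by (simp add: coeff_mult)
  moreover have "0 < coeff G 0" "0 < coeff H 0" using pos[of 0] by (simp_all add: poly_0_coeff_0)
  ultimately have c0: "coeff G 0 = 1" "coeff H 0 = 1" by (auto simp: zmult_eq_1_iff)
  have prod: "poly G 1 * poly H 1 = int p" using S(4) by simp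
  have degS: "degree (G * H) = degree G + degree H"
    using lc by (intro degree_mult_eq) auto
  obtain r where r: "r < p" "poly (G * H) 2 = fst (eval_at_2 p r)"
    using q_denom_at_2[OF p0, of a] unfolding GH by blast
  have big: "2 ^ (degree G + degree H) \<le> poly (G * H) 2"
    using nonneg_coeffs_monic_ge_power[OF S(3,1)] degS by simp
  show False
  proof (cases "p = 2 \<or> p = 3")
    case True
    \<comment> \<open>For these primes not all unit values are guaranteed. The bound 8 leaves only
      \<open>G = H = 1 + q\<close>, whose product takes the value 4 at 1.\<close>
    have "\<forall>p \<in> set [2, 3]. \<forall>r \<in> set [0..<p]. fst (eval_at_2 p r) < 8" by code_simp
    then have "poly (G * H) 2 < 8" using True r by auto
    then have "(2 :: int) ^ (degree G + degree H) < 2 ^ 3" using big by simp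
    then have "degree G + degree H < 3" by (simp only: power_strict_increasing_iff)
    then have "degree G = 1" "degree H = 1" using deg by simp_all
    then have "G = [:1, 1:]" "H = [:1, 1:]"
      using lc c0 by (auto simp: poly_eq_iff coeff_pCons coeff_eq_0 split: nat.split)
    then have "int p = 4" using prod by simp
    then show False using True by auto
  next
    case False
    have "odd p" using p False by (metis primes_dvd_imp_eq two_is_prime_nat)
    moreover have "prime (3 :: nat)" by simp
    then have "\<not> 3 dvd p" using p False by (metis primes_dvd_imp_eq)
    ultimately have u: "\<bar>poly G (- 1)\<bar> * \<bar>poly H (- 1)\<bar> = 1"
      "cmod (int_poly_at \<i> (G * H)) = 1" "cmod (int_poly_at \<omega> (G * H)) = 1"
      using S(5-7) by (simp_all add: abs_mult)
    then have u1: "\<bar>poly G (- 1)\<bar> = 1" "\<bar>poly H (- 1)\<bar> = 1"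
      by (auto simp: zmult_eq_1_iff)
    have u2: "cmod (int_poly_at \<i> (H * G)) = 1" "cmod (int_poly_at \<omega> (H * G)) = 1"
      using u by (simp_all only: mult.commute)
    have G: "(degree G, poly G 1, poly G 2) \<in> set small_values"
      using \<open>\<not> 7 \<le> degree G\<close> deg lc c0 u1 dvd_unit_at_i[OF u(2)] dvd_unit_at_\<omega>[OF u(3)]
      by (intro small_values_poly) auto
    have H: "(degree H, poly H 1, poly H 2) \<in> set small_values" if "\<not> 7 \<le> degree H"
      using that deg lc c0 u1 dvd_unit_at_i[OF u2(1)] dvd_unit_at_\<omega>[OF u2(2)]
      by (intro small_values_poly) auto
    \<comment> \<open>One of \<open>G(1)\<close> and \<open>H(1)\<close> is 1 since \<open>p\<close>
      is prime. No listed value is 1, so it is \<open>H(1)\<close>, and \<open>H\<close> lies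
      outside the range of the list.\<close>
    have ne1: "\<forall>(d, m, v) \<in> set small_values. m \<noteq> 1" by (simp add: small_values_def)
    have "poly G 1 \<noteq> 1" using ne1 G by fastforce
    moreover have "irreducible (int p)" using p by (simp add: prime_elem_imp_irreducible)
    then have "is_unit (poly G 1) \<or> is_unit (poly H 1)"
      using prod by (metis irreducibleD)
    ultimately have "poly H 1 = 1" using pos[of 1] by auto
    then have vals: "poly G 1 = int p" "poly H 1 = 1" using prod by simp_all
    have "7 \<le> degree H" using ne1 H vals by fastforce
    have "\<not> prime (25 :: nat)" "\<not> prime (35 :: nat)"
      by (auto simp: prime_nat_iff intro!: exI[of _ 5])
    then have "int p \<noteq> 25" "int p \<noteq> 35" using p by auto
    moreover have "r \<in> set [0..<nat (int p)]" using r by simp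
    moreover have "poly G 2 dvd fst (eval_at_2 p r)" unfolding r(2)[symmetric] by simp
    ultimately have "poly (G * H) 2 < 2 ^ (degree G + 7)"
      unfolding r(2) using bspec[OF small_values_not_dvd G] vals(1) r(1) by (simp add: Let_def)
    also have "\<dots> \<le> 2 ^ (degree G + degree H)"
      using \<open>7 \<le> degree H\<close> by (intro power_increasing) auto
    finally show False using big by simp
  qed
qed

theorem theorem7p10:
  fixes p :: nat and a :: int and S :: "rat poly"
  assumes "prime p"
    and "coprime a (int p)"
    and "S = map_poly rat_of_int (q_denom (rat_of_int a / rat_of_nat p))"
    and "reducible S"
  shows "\<forall>g. irreducible g \<and> g dvd S \<longrightarrow> 7 \<le> degree g"
proof (intro allI impI, elim conjE)
  fix g :: "rat poly"
  assume g: "irreducible g" "g dvd S"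
  then obtain h where h: "S = g * h" by blast
  have h0: "h \<noteq> 0" using assms(4) h by (auto simp: reducible_def)
  have "degree g \<noteq> 0"
    using g(1) by (auto simp: irreducible_def is_unit_iff_degree)
  \<comment> \<open>A constant cofactor would make \<open>S\<close> an associate of
    \<open>g\<close>, hence irreducible.\<close>
  moreover have "degree h \<noteq> 0"
  proof
    assume "degree h = 0"
    then have "is_unit h" using h0 by (simp add: is_unit_iff_degree)
    then have "irreducible S"
      using g(1) h by (metis irreducible_mult_unit_left mult.commute)
    then show False using assms(4) by (auto simp: reducible_def dest: irreducibleD)
  qed
  moreover have "lead_coeff (q_denom (rat_of_int a / rat_of_nat p)) = 1"
    using q_denom_properties(1)[OF prime_gt_0_nat] assms(1,2) by blast
  then obtain G H where "q_denom (rat_of_int a / rat_of_nat p) = G * H"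
    "degree G = degree g" "degree H = degree h" "lead_coeff G = 1" "lead_coeff H = 1"
    using gauss_rat_factor[of _ g h] assms(3) h by metis
  ultimately show "7 \<le> degree g"
    using no_small_factor[OF assms(1,2)] by (metis Suc_leI One_nat_def neq0_conv)
qed

end
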